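(* Let the matrices $V^{(1)}\in\mathbb{R}^{n\times\ell_1}$ and $V^{(2)}\in\mathbb{R}^{n\times\ell_2}$ have orthonormal columns, and let $\mathcal{B}$ denote the set of matrices of the form $B=B^{(2)}\otimes B^{(1)}$, where $B^{(i)}\in\mathbb{R}^{n\times n}$ and the range of $B^{(i)}$ is orthogonal to $\mathcal{R}(V^{(i)})$ for $i=1,2$. For $i=1,2$ let $P^{(i)}=I-V^{(i)}V^{(i)T}$ (an orthogonal projector), and let $P=P^{(2)}\otimes P^{(1)}$. Let $A=A^{(2)}\otimes A^{(1)}$ with $A^{(i)}\in\mathbb{R}^{n\times n}$, $i=1,2$. Then the matrix $\widehat{A}=PA$ is a closest matrix to $A$ in $\mathcal{B}$ in the Frobenius norm; that is, $\widehat{A}\in\mathcal{B}$ and $\|A-\widehat{A}\|_F\le\|A-B\|_F$ for all $B\in\mathcal{B}$.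
   Context: $\otimes$ denotes the Kronecker product of matrices, $\mathcal{R}(M)$ denotes the range (column space) of the matrix $M$, the superscript $^T$ denotes transposition, $I$ is the $n\times n$ identity matrix, and $\|M\|_F=\sqrt{\mathrm{trace}(M^TM)}$ is the Frobenius norm. *)

theory Defs
  imports "HOL-Analysis.Analysis"
begin

(* A matrix with r rows and c columns has type real^'c^'r, with CARD('r) = r and CARD('c) = c.
   The rows and columns of a Kronecker product are indexed by pairs; the usual block layout
   A $ i $ j *s B is obtained by ordering these pairs lexicographically. *)

definition kronecker ::
  "real^'c1^'r1 \<Rightarrow> real^'c2^'r2 \<Rightarrow> real^('c1 \<times> 'c2)^('r1 \<times> 'r2)" (infixl "\<otimes>\<^sub>K" 70)
  where "A \<otimes>\<^sub>K B = (\<chi> p q. A $ fst p $ fst q * B $ snd p $ snd q)"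

definition frobenius_norm :: "real^'c^'r \<Rightarrow> real"
  where "frobenius_norm M = sqrt (trace (transpose M ** M))"

definition mat_range :: "real^'c^'r \<Rightarrow> (real^'r) set"
  where "mat_range M = range (\<lambda>x. M *v x)"

definition orthonormal_columns :: "real^'c^'r \<Rightarrow> bool"
  where "orthonormal_columns V \<longleftrightarrow>
    (\<forall>i. norm (column i V) = 1) \<and> (\<forall>i j. i \<noteq> j \<longrightarrow> orthogonal (column i V) (column j V))"

definition orthogonal_ranges :: "real^'c^'r \<Rightarrow> real^'d^'r \<Rightarrow> bool"
  where "orthogonal_ranges B V \<longleftrightarrow> (\<forall>x \<in> mat_range B. \<forall>y \<in> mat_range V. orthogonal x y)"

definition kronecker_orth_set ::
  "real^'l1^'n \<Rightarrow> real^'l2^'n \<Rightarrow> (real^('n \<times> 'n)^('n \<times> 'n)) set"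
  where "kronecker_orth_set V1 V2 =
    {B2 \<otimes>\<^sub>K B1 | (B1 :: real^'n^'n) (B2 :: real^'n^'n).
       orthogonal_ranges B1 V1 \<and> orthogonal_ranges B2 V2}"

end

theory Submission
  imports Defs
begin

text \<open>The matrix \<open>P\<close> is symmetric and idempotent, the mixed-product rule gives \<open>P ** B = B\<close> for
  every admissible \<open>B\<close>, and left multiplication by \<open>P\<close> is self-adjoint for the trace inner
  product. Hence \<open>A - P ** A\<close> is orthogonal to \<open>P ** A - B = P ** (A - B)\<close> and Pythagoras
  applies.\<close>

lemma matrix_sub_ldistrib:
  fixes A :: "'a::ring_1^'n^'m"
  shows "A ** (B - C) = A ** B - A ** C"
  by (vector matrix_matrix_mult_def sum_subtractf [symmetric] right_diff_distrib)

lemma matrix_sub_rdistrib: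
  fixes A :: "'a::ring_1^'n^'m"
  shows "(A - B) ** C = A ** C - B ** C"
  by (vector matrix_matrix_mult_def sum_subtractf [symmetric] left_diff_distrib)

text \<open>Identifies the Frobenius norm with the library norm on \<open>real^'c^'r\<close>, so
  that the library's Pythagorean theorem applies.\<close>

lemma trace_transpose_mult_eq_inner:
  fixes M N :: "real^'c^'r"
  shows "trace (transpose M ** N) = M \<bullet> N"
proof -
  have "trace (transpose M ** N) = (\<Sum>i\<in>UNIV. \<Sum>k\<in>UNIV. M $ k $ i * N $ k $ i)"
    by (simp add: trace_def matrix_matrix_mult_def transpose_def)
  also have "\<dots> = M \<bullet> N"
    by (subst sum.swap) (simp add: inner_vec_def)
  finally show ?thesis .
qed

lemma frobenius_norm_eq_norm: "frobenius_norm M = norm M"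
  by (simp add: frobenius_norm_def trace_transpose_mult_eq_inner norm_eq_sqrt_inner)

text \<open>Both sides are the trace of \<open>transpose M ** transpose Q ** N\<close>.\<close>

lemma inner_matrix_mult_left:
  fixes Q :: "real^'s^'r" and M :: "real^'c^'s" and N :: "real^'c^'r"
  shows "(Q ** M) \<bullet> N = M \<bullet> (transpose Q ** N)"
  by (simp add: trace_transpose_mult_eq_inner [symmetric] matrix_transpose_mul matrix_mul_assoc)

lemma transpose_kronecker: "transpose (M \<otimes>\<^sub>K N) = transpose M \<otimes>\<^sub>K transpose N"
  by (simp add: kronecker_def transpose_def)

text \<open>Mixed-product rule: a sum over index pairs of a product of two terms, one per component,
  factors into two sums.\<close>

lemma kronecker_mult:
  "(M \<otimes>\<^sub>K N) ** (M' \<otimes>\<^sub>K N') = (M ** M') \<otimes>\<^sub>K (N ** N')"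
proof -
  have "(\<Sum>k\<in>UNIV. (M \<otimes>\<^sub>K N) $ p $ k * (M' \<otimes>\<^sub>K N') $ k $ q) =
      (\<Sum>i\<in>UNIV. M $ fst p $ i * M' $ i $ fst q) *
      (\<Sum>j\<in>UNIV. N $ snd p $ j * N' $ j $ snd q)" for p q
    unfolding UNIV_Times_UNIV [symmetric] sum.cartesian_product' sum_product
    by (simp add: kronecker_def mult_ac)
  then show ?thesis
    \<comment> \<open>\<open>kronecker_def\<close> is left to the second call so that the sum
      identity can first rewrite the entries of the product.\<close>
    by (simp add: vec_eq_iff matrix_matrix_mult_def) (simp add: kronecker_def)
qed

lemma orthonormal_columns_imp:
  fixes V :: "real^'l^'n"
  assumes "orthonormal_columns V"
  shows "transpose V ** V = mat 1"
  using assms unfolding orthonormal_columns_def matrix_mult_transpose_dot_column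
  by (auto simp: vec_eq_iff mat_def orthogonal_def norm_eq_1)

text \<open>Moving \<open>V\<close> across the inner product leaves vectors orthogonal to
  everything, hence zero. The range condition becomes a matrix equation that rewriting can
  use.\<close>

lemma orthogonal_ranges_iff:
  fixes B :: "real^'c^'r" and V :: "real^'d^'r"
  shows "orthogonal_ranges B V \<longleftrightarrow> transpose V ** B = 0"
proof -
  have "orthogonal_ranges B V \<longleftrightarrow> (\<forall>x y. (B *v x) \<bullet> (V *v y) = 0)"
    by (simp add: orthogonal_ranges_def mat_range_def orthogonal_def)
  also have "\<dots> \<longleftrightarrow> (\<forall>x y. ((transpose V ** B) *v x) \<bullet> y = 0)"
    by (metis dot_lmul_matrix inner_commute matrix_vector_mul_assoc transpose_matrix_vector)
  also have "\<dots> \<longleftrightarrow> transpose V ** B = 0"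
    by (simp add: matrix_eq)
  finally show ?thesis .
qed

text \<open>The situation of a single Kronecker factor, to be interpreted once for each of the
  two.\<close>

locale orthonormal_complement =
  fixes V :: "real^'l^'n" and P :: "real^'n^'n"
  assumes V: "orthonormal_columns V"
    and P: "P = mat 1 - V ** transpose V"
begin

lemma transpose_projector: "transpose P = P"
proof -
  have "transpose P = mat 1 - transpose (V ** transpose V)"
    unfolding P by (simp add: transpose_def mat_def vec_eq_iff)
  then show ?thesis
    by (simp add: P matrix_transpose_mul)
qed

lemma orthogonal_ranges_projector:
  fixes M :: "real^'c^'n"
  shows "orthogonal_ranges (P ** M) V"
proof -
  have "transpose V ** (V ** transpose V) = transpose V"
    by (simp add: matrix_mul_assoc orthonormal_columns_imp [OF V])
  then have "transpose V ** P = 0"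
    by (simp add: P matrix_sub_ldistrib)
  then show ?thesis
    by (simp add: orthogonal_ranges_iff matrix_mul_assoc)
qed

text \<open>The correction term \<open>V ** (transpose V ** M)\<close> vanishes.\<close>

lemma projector_fixes:
  fixes M :: "real^'c^'n"
  assumes "orthogonal_ranges M V"
  shows "P ** M = M"
  using assms
  by (simp add: P orthogonal_ranges_iff matrix_sub_rdistrib matrix_mul_assoc [symmetric])

end

lemma norm_diff_projection_le:
  fixes P :: "real^'r^'r" and A B :: "real^'c^'r"
  assumes "transpose P = P" and "P ** (P ** A) = P ** A" and "P ** B = B"
  shows "norm (A - P ** A) \<le> norm (A - B)"
proof -
  \<comment> \<open>Symmetry of \<open>P\<close> lets \<open>transpose P\<close> be written here, in
    the shape needed to move it to the other argument.\<close>
  have "(A - P ** A) \<bullet> (P ** A - B) = (A - P ** A) \<bullet> (transpose P ** (A - B))"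
    using assms by (simp add: matrix_sub_ldistrib)
  also have "\<dots> = (P ** (A - P ** A)) \<bullet> (A - B)"
    by (simp only: inner_matrix_mult_left)
  also have "\<dots> = 0"
    using assms by (simp add: matrix_sub_ldistrib)
  finally have "(norm (A - P ** A))\<^sup>2 + (norm (P ** A - B))\<^sup>2 = (norm (A - B))\<^sup>2"
    using norm_add_Pythagorean [of "A - P ** A" "P ** A - B"] by (simp add: orthogonal_def)
  then show ?thesis
    by (metis le_add_same_cancel1 norm_ge_zero power2_le_imp_le zero_le_power2)
qed

theorem corollary2p3:
  fixes V1 :: "real^'l1^'n" and V2 :: "real^'l2^'n"
    and A1 A2 P1 P2 :: "real^'n^'n"
    and P A Ahat :: "real^('n \<times> 'n)^('n \<times> 'n)"
  assumes "orthonormal_columns V1" and "orthonormal_columns V2"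
    and "P1 = mat 1 - V1 ** transpose V1"
    and "P2 = mat 1 - V2 ** transpose V2"
    and "P = P2 \<otimes>\<^sub>K P1"
    and "A = A2 \<otimes>\<^sub>K A1"
    and "Ahat = P ** A"
  shows "Ahat \<in> kronecker_orth_set V1 V2 \<and>
    (\<forall>B \<in> kronecker_orth_set V1 V2. frobenius_norm (A - Ahat) \<le> frobenius_norm (A - B))"
proof -
  interpret C1: orthonormal_complement V1 P1
    using assms by unfold_locales
  interpret C2: orthonormal_complement V2 P2
    using assms by unfold_locales
  \<comment> \<open>This exhibits the two factors that witness membership of
    \<open>Ahat\<close>.\<close>
  have "Ahat = (P2 ** A2) \<otimes>\<^sub>K (P1 ** A1)"
    using assms by (simp add: kronecker_mult)
  then have mem: "Ahat \<in> kronecker_orth_set V1 V2"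
    unfolding kronecker_orth_set_def
    using C1.orthogonal_ranges_projector C2.orthogonal_ranges_projector by blast
  have fixed: "P ** B = B" if "B \<in> kronecker_orth_set V1 V2" for B
    using that
    by (auto simp: kronecker_orth_set_def \<open>P = _\<close> kronecker_mult C1.projector_fixes C2.projector_fixes)
  have "transpose P = P"
    by (simp add: \<open>P = _\<close> transpose_kronecker C1.transpose_projector C2.transpose_projector)
  \<comment> \<open>Idempotence of \<open>P\<close> on \<open>A\<close> comes from
    \<open>fixed\<close> applied to \<open>Ahat\<close>, which is a member by
    \<open>mem\<close>.\<close>
  then show ?thesis
    using mem fixed norm_diff_projection_le [of P A]
    by (auto simp: frobenius_norm_eq_norm \<open>Ahat = P ** A\<close>)
qed

end
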